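(* Let $Q^*=\min_{y}Q(y)$ be the optimal value of $Q$ for unrestricted $y$ (i.e. over all $y\in\mathrm{dom}(Q)\subseteq\mathbb{R}^n$), assumed to be finite. Then for every $\hat y\in\mathbb{R}^n$ and for all sufficiently small $\hat\eta$ (i.e. there is a threshold $\eta_0\in\mathbb{R}$, depending on $\hat y$, such that this holds for every $\hat\eta\le\eta_0$), the $\ell_1$-deepest cut separating $(\hat y,\hat\eta)$ from $\mathcal{E}$ is the flat cut $\eta\ge Q^*$.
   Context: Data: $f\in\mathbb{R}^n$, $c\in\mathbb{R}^{n'}$, $b\in\mathbb{R}^m$, $A\in\mathbb{R}^{m\times n'}$, $B\in\mathbb{R}^{m\times n}$, $Y\subset\mathbb{Z}^n$. Standing assumption: the mixed-integer program $\min\{c^\top x+f^\top y: Ax+By\ge b,\ x\ge0,\ y\in Y\}$ is feasible and bounded. For $y\in\mathbb{R}^n$ let $Q(y)=f^\top y+\min\{c^\top x: Ax\ge b-By,\ x\ge0\}$, and let $\mathrm{dom}(Q)$ be the set of $y\in\mathbb{R}^n$ for which this linear program is feasible. The epigraph is $\mathcal{E}=\{(y,\eta)\in\mathbb{R}^{n+1}: y\in\mathrm{dom}(Q),\ \eta\ge Q(y)\}$. The cone of dual solutions is $\Pi=\{(\pi,\pi_0)\in\mathbb{R}^m\times\mathbb{R}:\pi^\top A\le\pi_0c^\top,\ \pi\ge0,\ \pi_0\ge0\}$. An $\ell_p$-deepest cut separating $(\hat y,\hat\eta)\notin\mathcal{E}$ from $\mathcal{E}$ is the inequality $\hat\pi^\top(b-By)+\hat\pi_0(f^\top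 y-\eta)\le0$ in the variables $(y,\eta)$, where $(\hat\pi,\hat\pi_0)$ is an optimal solution of $$\max_{(\pi,\pi_0)\in\Pi}\ \frac{\pi^\top(b-B\hat y)+\pi_0(f^\top\hat y-\hat\eta)}{\|(\pi^\top B-\pi_0f^\top,\ \pi_0)\|_p}$$ (only points with nonzero denominator are considered). Cuts are identified when they coincide up to a positive scaling of the inequality. *)

theory Defs
  imports "HOL-Analysis.Analysis"
begin

text \<open>
  Vectors live in \<open>real ^ 'n\<close>, \<open>real ^ 'k\<close>, \<open>real ^ 'm\<close>, for the integer variables, the
  continuous variables and the constraints respectively; \<open>\<le>\<close> on vectors is componentwise,
  and \<open>\<pi> v* A\<close> is the row vector \<open>\<pi>\<^sup>T A\<close>.
\<close>

definition mip_feasible ::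
  "real ^ 'm \<Rightarrow> real ^ 'k ^ 'm \<Rightarrow> real ^ 'n ^ 'm \<Rightarrow> (real ^ 'n) set \<Rightarrow> ((real ^ 'k) \<times> (real ^ 'n)) set"
  where "mip_feasible b A B Y = {(x, y). b \<le> A *v x + B *v y \<and> 0 \<le> x \<and> y \<in> Y}"

definition mip_feasible_bounded ::
  "real ^ 'n \<Rightarrow> real ^ 'k \<Rightarrow> real ^ 'm \<Rightarrow> real ^ 'k ^ 'm \<Rightarrow> real ^ 'n ^ 'm \<Rightarrow> (real ^ 'n) set \<Rightarrow> bool"
  where "mip_feasible_bounded f c b A B Y \<longleftrightarrow>
    mip_feasible b A B Y \<noteq> {} \<and>
    bdd_below ((\<lambda>(x, y). c \<bullet> x + f \<bullet> y) ` mip_feasible b A B Y)"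

definition sub_feasible ::
  "real ^ 'm \<Rightarrow> real ^ 'k ^ 'm \<Rightarrow> real ^ 'n ^ 'm \<Rightarrow> real ^ 'n \<Rightarrow> (real ^ 'k) set"
  where "sub_feasible b A B y = {x. b - B *v y \<le> A *v x \<and> 0 \<le> x}"

definition domQ ::
  "real ^ 'm \<Rightarrow> real ^ 'k ^ 'm \<Rightarrow> real ^ 'n ^ 'm \<Rightarrow> (real ^ 'n) set"
  where "domQ b A B = {y. sub_feasible b A B y \<noteq> {}}"

text \<open>
  Extended-real valued, so that no junk value is assigned to an infeasible (\<open>\<infinity>\<close>) or
  unbounded (\<open>-\<infinity>\<close>) linear program; a linear program with finite infimum attains it.
\<close>

definition Q ::
  "real ^ 'n \<Rightarrow> real ^ 'k \<Rightarrow> real ^ 'm \<Rightarrow> real ^ 'k ^ 'm \<Rightarrow> real ^ 'n ^ 'm \<Rightarrow> real ^ 'n \<Rightarrow> ereal"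
  where "Q f c b A B y = ereal (f \<bullet> y) + (INF x\<in>sub_feasible b A B y. ereal (c \<bullet> x))"

definition epigraph ::
  "real ^ 'n \<Rightarrow> real ^ 'k \<Rightarrow> real ^ 'm \<Rightarrow> real ^ 'k ^ 'm \<Rightarrow> real ^ 'n ^ 'm \<Rightarrow> ((real ^ 'n) \<times> real) set"
  where "epigraph f c b A B = {(y, \<eta>). y \<in> domQ b A B \<and> Q f c b A B y \<le> ereal \<eta>}"

definition dual_cone :: "real ^ 'k \<Rightarrow> real ^ 'k ^ 'm \<Rightarrow> ((real ^ 'm) \<times> real) set"
  where "dual_cone c A = {(\<pi>, \<pi>0). \<pi> v* A \<le> \<pi>0 *\<^sub>R c \<and> 0 \<le> \<pi> \<and> 0 \<le> \<pi>0}"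

definition lp_norm :: "ereal \<Rightarrow> (real ^ 'n) \<times> real \<Rightarrow> real"
  where "lp_norm p = (\<lambda>(v, v0).
    if p = \<infinity> then max (Max (range (\<lambda>i. \<bar>v $ i\<bar>))) \<bar>v0\<bar>
    else ((\<Sum>i\<in>UNIV. \<bar>v $ i\<bar> powr real_of_ereal p) + \<bar>v0\<bar> powr real_of_ereal p)
           powr (1 / real_of_ereal p))"

text \<open>
  An inequality in the variables \<open>(y, \<eta>)\<close> is represented by its left-hand side \<open>g\<close>, the
  inequality being \<open>g (y, \<eta>) \<le> 0\<close>.
\<close>

definition benders_cut ::
  "real ^ 'n \<Rightarrow> real ^ 'm \<Rightarrow> real ^ 'n ^ 'm \<Rightarrow> (real ^ 'm) \<times> real \<Rightarrow> (real ^ 'n) \<times> real \<Rightarrow> real"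
  where "benders_cut f b B = (\<lambda>(\<pi>, \<pi>0) (y, \<eta>). \<pi> \<bullet> (b - B *v y) + \<pi>0 * (f \<bullet> y - \<eta>))"

definition flat_cut :: "real \<Rightarrow> (real ^ 'n) \<times> real \<Rightarrow> real"
  where "flat_cut q = (\<lambda>(y, \<eta>). q - \<eta>)"

definition same_cut :: "((real ^ 'n) \<times> real \<Rightarrow> real) \<Rightarrow> ((real ^ 'n) \<times> real \<Rightarrow> real) \<Rightarrow> bool"
  where "same_cut g h \<longleftrightarrow> (\<exists>t>0. \<forall>z. g z = t * h z)"

definition cut_norm ::
  "ereal \<Rightarrow> real ^ 'n \<Rightarrow> real ^ 'n ^ 'm \<Rightarrow> (real ^ 'm) \<times> real \<Rightarrow> real"
  where "cut_norm p f B = (\<lambda>(\<pi>, \<pi>0). lp_norm p (\<pi> v* B - \<pi>0 *\<^sub>R f, \<pi>0))"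

definition deepest_solution ::
  "ereal \<Rightarrow> real ^ 'n \<Rightarrow> real ^ 'k \<Rightarrow> real ^ 'm \<Rightarrow> real ^ 'k ^ 'm \<Rightarrow> real ^ 'n ^ 'm \<Rightarrow>
   (real ^ 'n) \<times> real \<Rightarrow> (real ^ 'm) \<times> real \<Rightarrow> bool"
  where "deepest_solution p f c b A B z =
    is_arg_max (\<lambda>\<pi>. benders_cut f b B \<pi> z / cut_norm p f B \<pi>)
               (\<lambda>\<pi>. \<pi> \<in> dual_cone c A \<and> cut_norm p f B \<pi> \<noteq> 0)"

definition deepest_cut ::
  "ereal \<Rightarrow> real ^ 'n \<Rightarrow> real ^ 'k \<Rightarrow> real ^ 'm \<Rightarrow> real ^ 'k ^ 'm \<Rightarrow> real ^ 'n ^ 'm \<Rightarrow>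
   (real ^ 'n) \<times> real \<Rightarrow> ((real ^ 'n) \<times> real \<Rightarrow> real) \<Rightarrow> bool"
  where "deepest_cut p f c b A B z g \<longleftrightarrow>
    z \<notin> epigraph f c b A B \<and>
    (\<exists>\<pi>. deepest_solution p f c b A B z \<pi> \<and> g = benders_cut f b B \<pi>)"

end

theory Submission
  imports Defs
begin

text \<open>
  Minimising over unrestricted \<open>y\<close> gives one linear program, which by duality has a primal
  optimum \<open>(x\<^sub>0, y\<^sub>0)\<close> and a dual solution \<open>\<rho>\<close> with value \<open>Q\<^sup>*\<close>. Write \<open>w = \<pi>\<^sup>T B - \<pi>\<^sub>0 f\<close>. Testing a
  dual ray \<open>(\<pi>, \<pi>\<^sub>0)\<close> against \<open>(x\<^sub>0, y\<^sub>0)\<close> bounds the cut violation by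
  \<open>\<pi>\<^sub>0 (Q\<^sup>* - \<eta>) + w \<bullet> (y\<^sub>0 - y)\<close>, and \<open>w \<bullet> (y\<^sub>0 - y)\<close> is at most the 1-norm of \<open>w\<close> times a constant
  that does not depend on \<open>\<eta>\<close>. Once \<open>Q\<^sup>* - \<eta>\<close> exceeds this constant, the ratio is at most
  \<open>Q\<^sup>* - \<eta>\<close>, with equality only if \<open>w = 0\<close>. The ray \<open>(\<rho>, 1)\<close> attains equality, so all
  maximisers have \<open>w = 0\<close> and define the flat cut.
\<close>

section \<open>Attainment in linear programming\<close>

text \<open>Finite generation passes to linear images and makes them closed, which the separation
  argument in \<open>farkas\<close> relies on.\<close>

lemma nonneg_orthant_eq_convex_cone_hull:
  "{u :: 'a :: ordered_euclidean_space. 0 \<le> u} = convex_cone hull Basis"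
proof
  show "{u :: 'a. 0 \<le> u} \<subseteq> convex_cone hull Basis"
  proof
    fix u :: 'a assume "u \<in> {u. 0 \<le> u}"
    then have nonneg: "0 \<le> u \<bullet> i" if "i \<in> Basis" for i
      using that eucl_le[of 0 u] by simp
    have "(\<Sum>i\<in>I. (u \<bullet> i) *\<^sub>R i) \<in> convex_cone hull Basis" if "finite I" "I \<subseteq> Basis" for I
      using that
      by (induction I rule: finite_induct)
        (auto intro!: convex_cone_hull_add convex_cone_hull_mul convex_cone_hull_contains_0
          simp: nonneg hull_inc)
    from this[of Basis] show "u \<in> convex_cone hull Basis"
      by (simp add: euclidean_representation)
  qed
next
  have "convex_cone {u :: 'a. 0 \<le> u}"
    by (auto simp: convex_cone_iff intro: scaleR_nonneg_nonneg)
  moreover have "Basis \<subseteq> {u :: 'a. 0 \<le> u}"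
    by auto
  ultimately show "convex_cone hull Basis \<subseteq> {u :: 'a. 0 \<le> u}"
    by (rule hull_minimal[rotated])
qed

text \<open>The image of the orthant is a closed convex cone, so a hyperplane separates
  \<open>z\<close> from it. The cone contains 0, which makes the threshold negative, and its
  invariance under scaling then moves the threshold to 0.\<close>

lemma farkas:
  fixes L :: "'a :: ordered_euclidean_space \<Rightarrow> 'b :: euclidean_space"
  assumes "linear L" and "\<nexists>u. 0 \<le> u \<and> L u = z"
  obtains a where "a \<bullet> z < 0" and "\<And>u. 0 \<le> u \<Longrightarrow> 0 \<le> a \<bullet> L u"
proof -
  define K where "K = L ` {u. 0 \<le> u}"
  have K: "K = convex_cone hull (L ` Basis)"
    unfolding K_def nonneg_orthant_eq_convex_cone_hull
    by (rule convex_cone_hull_linear_image[OF assms(1), symmetric])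
  have "closed K" "convex K"
    unfolding K by (simp_all add: closed_convex_cone_hull convex_convex_cone_hull)
  moreover have "z \<notin> K"
    using assms(2) by (auto simp: K_def)
  ultimately have "\<exists>a \<beta>. a \<bullet> z < \<beta> \<and> (\<forall>v\<in>K. \<beta> < a \<bullet> v)"
    by (intro separating_hyperplane_closed_point)
  then obtain a \<beta> where a: "a \<bullet> z < \<beta>" "\<And>v. v \<in> K \<Longrightarrow> \<beta> < a \<bullet> v"
    by blast
  have "\<beta> < 0"
    using a(2)[of 0] by (simp add: K convex_cone_hull_contains_0)
  show ?thesis
  proof
    show "a \<bullet> z < 0"
      using a(1) \<open>\<beta> < 0\<close> by simp
    fix u :: 'a assume "0 \<le> u"
    show "0 \<le> a \<bullet> L u"
    proof (rule ccontr)
      assume neg: "\<not> 0 \<le> a \<bullet> L u"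
      \<comment> \<open>This factor scales \<open>L u\<close> to a point of \<open>K\<close> at
        which \<open>a\<close> takes exactly the value \<beta>, against the strict
        separation.\<close>
      define s where "s = \<beta> / (a \<bullet> L u)"
      have "0 \<le> s"
        using neg \<open>\<beta> < 0\<close> by (simp add: s_def divide_nonpos_neg)
      moreover have "L u \<in> K"
        using \<open>0 \<le> u\<close> by (simp add: K_def)
      ultimately have "s *\<^sub>R L u \<in> K"
        unfolding K by (intro convex_cone_hull_mul)
      from a(2)[OF this] show False
        using neg by (simp add: s_def)
    qed
  qed
qed

lemma inner_vec_nonneg:
  fixes u v :: "real ^ 'n"
  assumes "0 \<le> u" "0 \<le> v"
  shows "0 \<le> u \<bullet> v"
  using assms by (auto simp: inner_vec_def less_eq_vec_def intro: sum_nonneg)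

lemma vec_nonneg_if_inner_nonneg:
  fixes v :: "real ^ 'n"
  assumes "\<And>u. 0 \<le> u \<Longrightarrow> 0 \<le> u \<bullet> v"
  shows "0 \<le> v"
  unfolding less_eq_vec_def
proof
  fix i
  have "0 \<le> (axis i 1 :: real ^ 'n)"
    by (simp add: less_eq_vec_def axis_def)
  from assms[OF this] show "0 $ i \<le> v $ i"
    by (simp add: inner_axis')
qed

section \<open>Duality for linear programs with a free variable\<close>

text \<open>Nonnegative vectors are paired with nonnegative slacks. The vector
  \<open>\<pi> v* B\<close> is left arbitrary and \<open>d\<close> may be a multiple of the cost, so
  that every ray of the dual cone is covered.\<close>

lemma lp_weak_duality:
  fixes A :: "real ^ 'k ^ 'm" and B :: "real ^ 'n ^ 'm"
  assumes "0 \<le> x" "b \<le> A *v x + B *v y" "0 \<le> \<pi>" "\<pi> v* A \<le> d"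
  shows "\<pi> \<bullet> b \<le> d \<bullet> x + (\<pi> v* B) \<bullet> y"
proof -
  have "0 \<le> \<pi> \<bullet> (A *v x + B *v y - b)" "0 \<le> (d - \<pi> v* A) \<bullet> x"
    using assms by (auto intro: inner_vec_nonneg)
  then show ?thesis
    by (simp add: dot_lmul_matrix inner_add_right inner_diff_left inner_diff_right)
qed

text \<open>Farkas is applied to the dual constraints together with
  \<open>q \<le> \<rho> \<bullet> b\<close>, using slacks \<open>s\<close> and \<open>t\<close>. A
  certificate of insolubility is a homogenised primal point \<open>(x, y, \<tau>)\<close> that
  contradicts the lower bound \<open>q\<close>.\<close>

lemma lp_dual_attained:
  fixes A :: "real ^ 'k ^ 'm" and B :: "real ^ 'n ^ 'm"
  assumes feasible: "0 \<le> x1" "b \<le> A *v x1 + B *v y1"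
    and lower: "\<And>x y. 0 \<le> x \<Longrightarrow> b \<le> A *v x + B *v y \<Longrightarrow> q \<le> c \<bullet> x + f \<bullet> y"
  obtains \<rho> where "0 \<le> \<rho>" "\<rho> v* A \<le> c" "\<rho> v* B = f" "q \<le> \<rho> \<bullet> b"
proof (rule ccontr)
  assume no_dual: "\<not> thesis"
  define L :: "(real ^ 'm) \<times> (real ^ 'k) \<times> real \<Rightarrow> (real ^ 'k) \<times> (real ^ 'n) \<times> real"
    where "L = (\<lambda>(\<pi>, s, t). (\<pi> v* A + s, \<pi> v* B, t - \<pi> \<bullet> b))"
  have "linear L"
    by (rule linearI)
      (auto simp: L_def vector_matrix_left_distrib scaleR_vector_matrix_assoc
        inner_add_left algebra_simps)
  moreover have "\<nexists>u. 0 \<le> u \<and> L u = (c, f, - q)"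
  proof safe
    fix \<pi> s t assume "0 \<le> (\<pi>, s, t)" and eq: "L (\<pi>, s, t) = (c, f, - q)"
    then have "0 \<le> \<pi>" "0 \<le> s" "0 \<le> t"
      by (auto simp: less_eq_prod_def)
    moreover have "c = \<pi> v* A + s" "\<pi> v* B = f" "\<pi> \<bullet> b = q + t"
      using eq by (auto simp: L_def)
    ultimately show False
      using no_dual that[of \<pi>] by simp
  qed
  ultimately obtain a where a: "a \<bullet> (c, f, - q) < 0" "\<And>u. 0 \<le> u \<Longrightarrow> 0 \<le> a \<bullet> L u"
    using farkas by blast
  obtain x y \<tau> where xy: "a = (x, y, \<tau>)"
    by (cases a) auto
  have neg: "c \<bullet> x + f \<bullet> y < \<tau> * q"
    using a(1) by (simp add: xy inner_commute)
  have "0 \<le> s \<bullet> x" if "0 \<le> s" for s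
    using a(2)[of "(0, s, 0)"] that
    by (simp add: xy L_def less_eq_prod_def inner_commute)
  then have "0 \<le> x"
    by (rule vec_nonneg_if_inner_nonneg)
  have "0 \<le> \<tau>"
    using a(2)[of "(0, 0, 1)"] by (simp add: xy L_def less_eq_prod_def)
  have "0 \<le> \<pi> \<bullet> (A *v x + B *v y - \<tau> *\<^sub>R b)" if "0 \<le> \<pi>" for \<pi>
    using a(2)[of "(\<pi>, 0, 0)"] that
    by (simp add: xy L_def less_eq_prod_def inner_commute[of x] inner_commute[of y]
        dot_lmul_matrix inner_add_right inner_diff_right)
  then have "0 \<le> A *v x + B *v y - \<tau> *\<^sub>R b"
    by (rule vec_nonneg_if_inner_nonneg)
  then have Axy: "\<tau> *\<^sub>R b \<le> A *v x + B *v y"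
    by simp
  show False
  proof (cases "\<tau> = 0")
    case True
    \<comment> \<open>\<open>(x, y)\<close> is a recession direction along which the objective decreases; one needs to
        walk along it far enough to get below \<open>q\<close>.\<close>
    define d where "d = - (c \<bullet> x + f \<bullet> y)"
    define r where "r = (\<bar>c \<bullet> x1 + f \<bullet> y1 - q\<bar> + 1) / d"
    have "0 < d"
      using neg True by (simp add: d_def)
    then have "0 \<le> r" "r * d = \<bar>c \<bullet> x1 + f \<bullet> y1 - q\<bar> + 1"
      by (auto simp: r_def)
    have "0 \<le> r *\<^sub>R (A *v x + B *v y)"
      using Axy True \<open>0 \<le> r\<close> by (auto intro: scaleR_nonneg_nonneg)
    with feasible(2) have "b + 0 \<le> (A *v x1 + B *v y1) + r *\<^sub>R (A *v x + B *v y)"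
      by (rule add_mono)
    then have "b \<le> A *v (x1 + r *\<^sub>R x) + B *v (y1 + r *\<^sub>R y)"
      by (simp add: algebra_simps)
    moreover have "0 \<le> x1 + r *\<^sub>R x"
      using feasible(1) \<open>0 \<le> x\<close> \<open>0 \<le> r\<close> by (simp add: scaleR_nonneg_nonneg)
    ultimately have "q \<le> c \<bullet> (x1 + r *\<^sub>R x) + f \<bullet> (y1 + r *\<^sub>R y)"
      by (intro lower)
    also have "\<dots> = c \<bullet> x1 + f \<bullet> y1 - r * d"
      by (simp add: d_def inner_add_right algebra_simps)
    finally show False
      using \<open>r * d = _\<close> by linarith
  next
    case False
    with \<open>0 \<le> \<tau>\<close> have "0 < \<tau>" by simp
    \<comment> \<open>Dehomogenising yields a feasible point whose value is below
      \<open>q\<close>.\<close>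
    have "inverse \<tau> *\<^sub>R \<tau> *\<^sub>R b \<le> inverse \<tau> *\<^sub>R (A *v x + B *v y)"
      using Axy \<open>0 < \<tau>\<close> by (intro scaleR_left_mono) auto
    then have "b \<le> A *v (inverse \<tau> *\<^sub>R x) + B *v (inverse \<tau> *\<^sub>R y)"
      using \<open>0 < \<tau>\<close> by (simp add: matrix_vector_mult_scaleR scaleR_add_right)
    moreover have "0 \<le> inverse \<tau> *\<^sub>R x"
      using \<open>0 \<le> x\<close> \<open>0 < \<tau>\<close> by (simp add: scaleR_nonneg_nonneg)
    ultimately have "q \<le> c \<bullet> (inverse \<tau> *\<^sub>R x) + f \<bullet> (inverse \<tau> *\<^sub>R y)"
      by (intro lower)
    then have "\<tau> * q \<le> c \<bullet> x + f \<bullet> y"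
      using \<open>0 < \<tau>\<close> by (simp add: field_simps)
    with neg show False by simp
  qed
qed

text \<open>If no feasible point has value at most \<open>q\<close>, Farkas supplies multipliers
  \<open>(\<pi>, \<tau>)\<close>. For \<tau> > 0 they prove a lower bound above \<open>q\<close>,
  against \<open>greatest\<close>; for \<tau> = 0 they refute the feasibility of
  \<open>(x1, y1)\<close>.\<close>

lemma lp_primal_attained:
  fixes A :: "real ^ 'k ^ 'm" and B :: "real ^ 'n ^ 'm"
  assumes feasible: "0 \<le> x1" "b \<le> A *v x1 + B *v y1"
    and greatest: "\<And>r. (\<And>x y. 0 \<le> x \<Longrightarrow> b \<le> A *v x + B *v y \<Longrightarrow> r \<le> c \<bullet> x + f \<bullet> y) \<Longrightarrow> r \<le> q"
  obtains x y where "0 \<le> x" "b \<le> A *v x + B *v y" "c \<bullet> x + f \<bullet> y \<le> q"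
proof (rule ccontr)
  assume no_primal: "\<not> thesis"
  \<comment> \<open>The free variable is split as \<open>y = y' - y''\<close> with \<open>y', y'' \<ge> 0\<close>.\<close>
  define L :: "(real ^ 'k) \<times> (real ^ 'n) \<times> (real ^ 'n) \<times> (real ^ 'm) \<times> real \<Rightarrow> (real ^ 'm) \<times> real"
    where "L = (\<lambda>(x, y', y'', s, t).
      (A *v x + B *v (y' - y'') - s, c \<bullet> x + f \<bullet> (y' - y'') + t))"
  have "linear L"
    by (rule linearI)
      (auto simp: L_def matrix_vector_right_distrib matrix_vector_mult_diff_distrib
        matrix_vector_mult_scaleR inner_add_right inner_diff_right algebra_simps)
  moreover have "\<nexists>u. 0 \<le> u \<and> L u = (b, q)"
  proof safe
    fix x y' y'' s t assume "0 \<le> (x, y', y'', s, t)" and eq: "L (x, y', y'', s, t) = (b, q)"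
    then have "0 \<le> x" "0 \<le> s" "0 \<le> t"
      by (auto simp: less_eq_prod_def)
    moreover have "A *v x + B *v (y' - y'') = b + s" "c \<bullet> x + f \<bullet> (y' - y'') = q - t"
      using eq by (auto simp: L_def algebra_simps)
    ultimately show False
      using no_primal that[of x "y' - y''"] by simp
  qed
  ultimately obtain a where a: "a \<bullet> (b, q) < 0" "\<And>u. 0 \<le> u \<Longrightarrow> 0 \<le> a \<bullet> L u"
    using farkas by blast
  obtain \<sigma> \<tau> where \<sigma>: "a = (\<sigma>, \<tau>)"
    by (cases a) auto
  \<comment> \<open>The surplus \<open>s\<close> enters \<open>L\<close> with a minus sign, so it is
    the negated multiplier that is nonnegative.\<close>
  define \<pi> where "\<pi> = - \<sigma>"
  have a_eq: "a = (- \<pi>, \<tau>)"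
    by (simp add: \<sigma> \<pi>_def)
  have gt: "\<tau> * q < \<pi> \<bullet> b"
    using a(1) by (simp add: a_eq)
  have "0 \<le> s \<bullet> \<pi>" if "0 \<le> s" for s
    using a(2)[of "(0, 0, 0, s, 0)"] that
    by (simp add: a_eq L_def less_eq_prod_def inner_commute)
  then have "0 \<le> \<pi>"
    by (rule vec_nonneg_if_inner_nonneg)
  have "0 \<le> \<tau>"
    using a(2)[of "(0, 0, 0, 0, 1)"] by (simp add: a_eq L_def less_eq_prod_def)
  have "0 \<le> x \<bullet> (\<tau> *\<^sub>R c - \<pi> v* A)" if "0 \<le> x" for x
    using a(2)[of "(x, 0, 0, 0, 0)"] that
    by (simp add: a_eq L_def less_eq_prod_def dot_lmul_matrix inner_diff_right
        inner_commute[of x])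
  then have "0 \<le> \<tau> *\<^sub>R c - \<pi> v* A"
    by (rule vec_nonneg_if_inner_nonneg)
  then have \<pi>A: "\<pi> v* A \<le> \<tau> *\<^sub>R c"
    by simp
  \<comment> \<open>The two halves of the free variable give opposite inequalities, hence the
    equation \<open>\<pi>B\<close>.\<close>
  have "0 \<le> y \<bullet> (\<tau> *\<^sub>R f - \<pi> v* B)" if "0 \<le> y" for y
    using a(2)[of "(0, y, 0, 0, 0)"] that
    by (simp add: a_eq L_def less_eq_prod_def dot_lmul_matrix inner_diff_right
        inner_commute[of y])
  then have "0 \<le> \<tau> *\<^sub>R f - \<pi> v* B"
    by (rule vec_nonneg_if_inner_nonneg)
  moreover have "0 \<le> y \<bullet> (\<pi> v* B - \<tau> *\<^sub>R f)" if "0 \<le> y" for y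
    using a(2)[of "(0, 0, y, 0, 0)"] that
    by (simp add: a_eq L_def less_eq_prod_def dot_lmul_matrix inner_diff_right
        inner_commute[of y] matrix_vector_mult_diff_distrib)
  then have "0 \<le> \<pi> v* B - \<tau> *\<^sub>R f"
    by (rule vec_nonneg_if_inner_nonneg)
  ultimately have \<pi>B: "\<pi> v* B = \<tau> *\<^sub>R f"
    by (simp add: antisym)
  have bound: "\<pi> \<bullet> b \<le> \<tau> * (c \<bullet> x + f \<bullet> y)" if "0 \<le> x" "b \<le> A *v x + B *v y" for x y
    using lp_weak_duality[OF that \<open>0 \<le> \<pi>\<close> \<pi>A] by (simp add: \<pi>B algebra_simps)
  show False
  proof (cases "\<tau> = 0")
    case True
    then show False
      using bound[OF feasible] gt by simp
  next
    case False
    with \<open>0 \<le> \<tau>\<close> have "0 < \<tau>" by simp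
    then have "\<pi> \<bullet> b / \<tau> \<le> q"
      by (intro greatest) (auto dest!: bound simp: field_simps)
    with gt \<open>0 < \<tau>\<close> show False
      by (simp add: field_simps)
  qed
qed

section \<open>Benders cuts and the 1-norm\<close>

lemma lp_norm_1: "lp_norm 1 (w, t) = (\<Sum>i\<in>UNIV. \<bar>w $ i\<bar>) + \<bar>t\<bar>"
  by (simp add: lp_norm_def sum_nonneg)

text \<open>Hoelder's inequality for the 1-norm and its dual, the maximum norm.\<close>

lemma inner_le_sum_abs_mult_Max:
  fixes w v :: "real ^ 'n"
  shows "w \<bullet> v \<le> (\<Sum>i\<in>UNIV. \<bar>w $ i\<bar>) * Max (range (\<lambda>i. \<bar>v $ i\<bar>))"
  unfolding inner_vec_def sum_distrib_right
proof (rule sum_mono)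
  fix i
  have "w $ i \<bullet> v $ i \<le> \<bar>w $ i\<bar> * \<bar>v $ i\<bar>"
    by (metis abs_ge_self abs_mult inner_real_def)
  also have "\<dots> \<le> \<bar>w $ i\<bar> * Max (range (\<lambda>i. \<bar>v $ i\<bar>))"
    by (intro mult_left_mono Max_ge) auto
  finally show "w $ i \<bullet> v $ i \<le> \<bar>w $ i\<bar> * Max (range (\<lambda>i. \<bar>v $ i\<bar>))" .
qed

text \<open>Collecting the terms in \<open>y\<close> exposes the vector measured by
  \<open>cut_norm\<close>; where it vanishes, the cut does not depend on \<open>y\<close>.\<close>

lemma benders_cut_eq:
  "benders_cut f b B (\<pi>, \<pi>0) (y, \<eta>) = \<pi> \<bullet> b - (\<pi> v* B - \<pi>0 *\<^sub>R f) \<bullet> y - \<pi>0 * \<eta>"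
  by (simp add: benders_cut_def dot_lmul_matrix inner_diff_left inner_diff_right algebra_simps)

text \<open>Testing \<open>Q\<close> against real lower bounds avoids extended arithmetic later:
  infeasibility makes both sides true, unboundedness both false.\<close>

lemma Q_lower_bound_iff:
  "ereal r \<le> Q f c b A B y \<longleftrightarrow> (\<forall>x\<in>sub_feasible b A B y. r \<le> c \<bullet> x + f \<bullet> y)"
proof -
  have "ereal r \<le> Q f c b A B y \<longleftrightarrow>
      ereal (r - f \<bullet> y) \<le> (INF x\<in>sub_feasible b A B y. ereal (c \<bullet> x))"
    unfolding Q_def
    by (cases "INF x\<in>sub_feasible b A B y. ereal (c \<bullet> x)") auto
  also have "\<dots> \<longleftrightarrow> (\<forall>x\<in>sub_feasible b A B y. r \<le> c \<bullet> x + f \<bullet> y)"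
    by (auto simp: le_INF_iff algebra_simps)
  finally show ?thesis .
qed

text \<open>Merges the outer infimum and the inner program into one linear program in
  \<open>(x, y)\<close>; outside \<open>domQ\<close> there is no \<open>x\<close> to test.\<close>

lemma INF_Q_lower_bound_iff:
  "ereal r \<le> (INF y\<in>domQ b A B. Q f c b A B y) \<longleftrightarrow>
    (\<forall>x y. 0 \<le> x \<longrightarrow> b \<le> A *v x + B *v y \<longrightarrow> r \<le> c \<bullet> x + f \<bullet> y)"
  by (auto simp: le_INF_iff Q_lower_bound_iff domQ_def sub_feasible_def diff_le_eq)

section \<open>Identification of the deepest cuts\<close>

theorem proposition3:
  fixes f :: "real ^ 'n" and c :: "real ^ 'k" and b :: "real ^ 'm"
    and A :: "real ^ 'k ^ 'm" and B :: "real ^ 'n ^ 'm"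
    and Y :: "(real ^ 'n) set" and Qstar :: real
  assumes "\<forall>y\<in>Y. \<forall>i. y $ i \<in> \<int>"
    and "mip_feasible_bounded f c b A B Y"
    and "(INF y\<in>domQ b A B. Q f c b A B y) = ereal Qstar"
  shows "\<forall>y_hat :: real ^ 'n. \<exists>\<eta>0 :: real. \<forall>\<eta>_hat\<le>\<eta>0.
           (\<exists>g. deepest_cut 1 f c b A B (y_hat, \<eta>_hat) g) \<and>
           (\<forall>g. deepest_cut 1 f c b A B (y_hat, \<eta>_hat) g \<longrightarrow> same_cut g (flat_cut Qstar))"
proof
  fix y_hat :: "real ^ 'n"
  have lower: "Qstar \<le> c \<bullet> x + f \<bullet> y" if "0 \<le> x" "b \<le> A *v x + B *v y" for x y
    using INF_Q_lower_bound_iff[of Qstar f c b A B] assms(3) that by simp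
  have greatest: "r \<le> Qstar"
    if "\<And>x y. 0 \<le> x \<Longrightarrow> b \<le> A *v x + B *v y \<Longrightarrow> r \<le> c \<bullet> x + f \<bullet> y" for r
    using INF_Q_lower_bound_iff[of r f c b A B] assms(3) that by simp
  obtain x1 y1 where feasible: "0 \<le> x1" "b \<le> A *v x1 + B *v y1"
    using assms(2) by (auto simp: mip_feasible_bounded_def mip_feasible_def)
  obtain \<rho> where \<rho>: "0 \<le> \<rho>" "\<rho> v* A \<le> c" "\<rho> v* B = f" "Qstar \<le> \<rho> \<bullet> b"
    using lp_dual_attained[OF feasible lower] by blast
  obtain x0 y0 where opt: "0 \<le> x0" "b \<le> A *v x0 + B *v y0" "c \<bullet> x0 + f \<bullet> y0 \<le> Qstar"
    using lp_primal_attained[OF feasible greatest] by blast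
  \<comment> \<open>The Hoelder constant for \<open>w \<bullet> (y0 - y_hat)\<close>; it depends on
    \<open>y_hat\<close> but not on \<eta>.\<close>
  define K where "K = Max (range (\<lambda>i. \<bar>(y0 - y_hat) $ i\<bar>))"
  have "0 \<le> K"
    unfolding K_def by (rule order.trans[OF abs_ge_zero Max_ge]) auto
  show "\<exists>\<eta>0. \<forall>\<eta>_hat\<le>\<eta>0.
      (\<exists>g. deepest_cut 1 f c b A B (y_hat, \<eta>_hat) g) \<and>
      (\<forall>g. deepest_cut 1 f c b A B (y_hat, \<eta>_hat) g \<longrightarrow> same_cut g (flat_cut Qstar))"
  \<comment> \<open>This threshold forces \<delta> > \<open>K\<close> and, as \<open>K\<close> is
    nonnegative, also \<eta> < \<open>Qstar\<close>, which places the point outside the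
    epigraph.\<close>
  proof (intro exI[of _ "Qstar - K - 1"] allI impI)
    fix \<eta> assume \<eta>: "\<eta> \<le> Qstar - K - 1"
    define \<delta> where "\<delta> = Qstar - \<eta>"
    have "K < \<delta>"
      using \<eta> by (simp add: \<delta>_def)
    let ?z = "(y_hat, \<eta>)"
    let ?S = "\<lambda>p. p \<in> dual_cone c A \<and> cut_norm 1 f B p \<noteq> 0"
    let ?W = "\<lambda>\<pi> \<pi>0. \<Sum>i\<in>UNIV. \<bar>(\<pi> v* B - \<pi>0 *\<^sub>R f) $ i\<bar>"
    have norm: "cut_norm 1 f B (\<pi>, \<pi>0) = ?W \<pi> \<pi>0 + \<bar>\<pi>0\<bar>" for \<pi> \<pi>0
      by (simp add: cut_norm_def lp_norm_1)
    have weak: "\<pi> \<bullet> b \<le> \<pi>0 * Qstar + (\<pi> v* B - \<pi>0 *\<^sub>R f) \<bullet> y0"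
      if p: "(\<pi>, \<pi>0) \<in> dual_cone c A" for \<pi> \<pi>0
    proof -
      have "\<pi> \<bullet> b \<le> \<pi>0 *\<^sub>R c \<bullet> x0 + (\<pi> v* B) \<bullet> y0"
        using p by (intro lp_weak_duality[OF opt(1,2)]) (auto simp: dual_cone_def)
      moreover have "\<pi>0 * (c \<bullet> x0 + f \<bullet> y0) \<le> \<pi>0 * Qstar"
        using p opt(3) by (intro mult_left_mono) (auto simp: dual_cone_def)
      ultimately show ?thesis
        by (simp add: inner_diff_left algebra_simps)
    qed
    have violation: "benders_cut f b B (\<pi>, \<pi>0) ?z \<le> \<pi>0 * \<delta> + ?W \<pi> \<pi>0 * K"
      if p: "(\<pi>, \<pi>0) \<in> dual_cone c A" for \<pi> \<pi>0
      using weak[OF p] inner_le_sum_abs_mult_Max[of "\<pi> v* B - \<pi>0 *\<^sub>R f" "y0 - y_hat"]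
      by (simp add: benders_cut_eq K_def \<delta>_def inner_diff_right algebra_simps)
    have ratio_le: "benders_cut f b B p ?z / cut_norm 1 f B p \<le> \<delta>" if "?S p" for p
    proof -
      obtain \<pi> \<pi>0 where p: "p = (\<pi>, \<pi>0)" by (cases p)
      have "0 \<le> \<pi>0" "0 \<le> ?W \<pi> \<pi>0" "0 < ?W \<pi> \<pi>0 + \<pi>0"
        using that sum_nonneg[of UNIV "\<lambda>i. \<bar>(\<pi> v* B - \<pi>0 *\<^sub>R f) $ i\<bar>"]
        by (auto simp: p norm dual_cone_def order.strict_iff_order)
      \<comment> \<open>Replacing \<open>K\<close> by \<delta> turns the bound in
        \<open>violation\<close> into \<delta> times the denominator.\<close>
      moreover from this have "?W \<pi> \<pi>0 * K \<le> ?W \<pi> \<pi>0 * \<delta>"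
        using \<open>K < \<delta>\<close> by (intro mult_left_mono) auto
      ultimately show ?thesis
        using violation[of \<pi> \<pi>0] that by (simp add: p norm divide_le_eq algebra_simps)
    qed
    have \<rho>_sol: "?S (\<rho>, 1)"
      using \<rho> by (simp add: dual_cone_def norm)
    \<comment> \<open>Here \<open>\<rho> v* B = f\<close>, so the denominator is 1 and the ratio is
      \<open>\<rho> \<bullet> b - \<eta>\<close>.\<close>
    have \<rho>_ratio: "\<delta> \<le> benders_cut f b B (\<rho>, 1) ?z / cut_norm 1 f B (\<rho>, 1)"
      using \<rho> by (simp add: benders_cut_eq norm \<delta>_def)
    have "Qstar \<le> \<eta>" if "?z \<in> epigraph f c b A B"
    proof -
      have "ereal Qstar \<le> Q f c b A B y_hat"
        using lower by (auto simp: Q_lower_bound_iff sub_feasible_def diff_le_eq)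
      also have "\<dots> \<le> ereal \<eta>"
        using that by (simp add: epigraph_def)
      finally show ?thesis by simp
    qed
    then have outside: "?z \<notin> epigraph f c b A B"
      using \<eta> \<open>0 \<le> K\<close> by auto
    have "deepest_solution 1 f c b A B ?z (\<rho>, 1)"
      unfolding deepest_solution_def is_arg_max_def
      using \<rho>_sol \<rho>_ratio ratio_le by (meson order.trans not_less)
    then have "\<exists>g. deepest_cut 1 f c b A B ?z g"
      using outside by (auto simp: deepest_cut_def)
    moreover have "same_cut g (flat_cut Qstar)" if cut: "deepest_cut 1 f c b A B ?z g" for g
    proof -
      obtain \<pi> \<pi>0 where sol: "deepest_solution 1 f c b A B ?z (\<pi>, \<pi>0)"
        and g: "g = benders_cut f b B (\<pi>, \<pi>0)"
        using cut by (auto simp: deepest_cut_def)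
      have S: "?S (\<pi>, \<pi>0)"
        and ratio: "\<delta> \<le> benders_cut f b B (\<pi>, \<pi>0) ?z / cut_norm 1 f B (\<pi>, \<pi>0)"
        using sol \<rho>_sol \<rho>_ratio unfolding deepest_solution_def is_arg_max_def
        by (auto simp: not_less intro: order.trans)
      have nonneg: "0 \<le> \<pi>0" "0 \<le> ?W \<pi> \<pi>0"
        using S by (auto simp: dual_cone_def sum_nonneg)
      then have pos: "0 < ?W \<pi> \<pi>0 + \<pi>0"
        using S by (auto simp: norm order.strict_iff_order sum_nonneg)
      then have reached: "\<delta> * (?W \<pi> \<pi>0 + \<pi>0) \<le> benders_cut f b B (\<pi>, \<pi>0) ?z"
        using ratio nonneg by (simp add: norm le_divide_eq)
      \<comment> \<open>The terms \<open>\<pi>0 * \<delta>\<close> cancel between the two bounds on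
        the violation.\<close>
      with violation[of \<pi> \<pi>0] S have "?W \<pi> \<pi>0 * (\<delta> - K) \<le> 0"
        by (simp add: algebra_simps)
      with \<open>K < \<delta>\<close> have "?W \<pi> \<pi>0 \<le> 0"
        by (simp add: mult_le_0_iff)
      with nonneg(2) have W0: "?W \<pi> \<pi>0 = 0"
        by (rule antisym[rotated])
      then have w0: "\<pi> v* B - \<pi>0 *\<^sub>R f = 0"
        by (simp add: sum_nonneg_eq_0_iff vec_eq_iff)
      \<comment> \<open>A vanishing \<pi>0 would now make the denominator zero.\<close>
      have "0 < \<pi>0"
        using pos W0 by simp
      \<comment> \<open>Weak duality and the attained ratio together fix the constant term of the
        cut at \<open>\<pi>0 * Qstar\<close>.\<close>
      have "\<pi> \<bullet> b \<le> \<pi>0 * Qstar"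
        using weak[of \<pi> \<pi>0] S w0 by simp
      moreover have "\<pi>0 * Qstar \<le> \<pi> \<bullet> b"
        using reached unfolding benders_cut_eq w0 W0 by (simp add: \<delta>_def algebra_simps)
      ultimately have "g z = \<pi>0 * flat_cut Qstar z" for z
        by (cases z) (simp add: g benders_cut_eq w0 flat_cut_def algebra_simps)
      then show ?thesis
        using \<open>0 < \<pi>0\<close> by (auto simp: same_cut_def)
    qed
    ultimately show "(\<exists>g. deepest_cut 1 f c b A B ?z g) \<and>
        (\<forall>g. deepest_cut 1 f c b A B ?z g \<longrightarrow> same_cut g (flat_cut Qstar))"
      by blast
  qed
qed

end
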